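(* For every classical knot diagram $D$ with a base point (equivalently, every classical long knot diagram), $v_{3,7}(D)=\left\langle 2X+H,\ D\right\rangle$, where $v_{3,7}=\left\langle f_{3,7},\cdot\right\rangle$, $f_{3,7}=\sum_{m=1}^{6}H_m+2\,(X_1+X_2)$, and the unbased unsigned arrow diagrams $X,H$ and the based unsigned arrow diagrams $X_1,X_2,H_1,\dots,H_6$ are the ones given in the context. That is, the Gauss diagram formula $v_{3,7}(\cdot)$ for based diagrams coincides with the Polyak-Viro formula $\left\langle 2X+H,\cdot\right\rangle$ evaluated on the diagram with its base point forgotten.
   Context: Oriented Gauss words. An oriented Gauss word is a finite word in which every letter occurs exactly twice, once plain ($i$, the tail, corresponding to the over-passage) and once barred ($\bar i$, the head, corresponding to the under-passage); each letter carries a sign $\pm1$ (the sign of the crossing). A based arrow diagram is a class of such words up to sign-preserving relabeling of letters. An unbased arrow diagram is a class up to relabeling and cyclic rotation of the word. A knot diagram with a base point and an orientation gives an oriented Gauss word by travelling along the diagram from the base point and recording the passages through crossings; its class is the based arrow diagram of the diagram, and forgetting the base point (passing to the cyclic class) gives the unbased arrow diagram. Pairing. For an arrow diagram $x^*$ (with signs) and a diagram $D$ with oriented Gauss word $G$, put $\langle x^*,D\rangle=\sum_{H'}\operatorname{sign}(H')$, where $H'$ runs over all words obtained from $G$ by deleting (both occurrences of) some letters and whose class is $x^*$, and $\operatorname{sign}(H')$ is the product of the signs of the letters of $H'$. For based $x^*$ the class is taken in the based sense, and for unbased $x^*$ in the cyclic sense. An unsigned arrow diagram denotes the sum of all arrow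 diagrams obtained from it by assigning signs to its arrows, so pairing it with $D$ sums $\operatorname{sign}(H')$ over all subwords $H'$ whose underlying unsigned class is the given one. The pairing is extended linearly in the first argument. The diagrams (signs omitted). $X$ is the unbased unsigned arrow diagram of the cyclic word $\bar1\,3\,\bar2\,1\,\bar3\,2$ (three mutually crossing arrows with heads and tails alternating along the circle). $X_1,X_2$ are the two based unsigned arrow diagrams obtained from $X$ by choosing a base point, namely the words $\bar2\,1\,\bar3\,2\,\bar1\,3$ and $3\,\bar2\,1\,\bar3\,2\,\bar1$. $H$ is the unbased unsigned arrow diagram of the cyclic word $\bar c\,b\,\bar a\,c\,a\,\bar b$ (two non-crossing antiparallel arrows $a,b$, both crossed by the arrow $c$). $H_1,\dots,H_6$ are the six based unsigned arrow diagrams obtained from $H$ by choosing a base point, i.e. the six cyclic rotations of the word $\bar c\,b\,\bar a\,c\,a\,\bar b$. *)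

theory Defs
  imports "HOL-Analysis.Analysis" "HOL-Library.Poly_Mapping"
begin

section \<open>Oriented Gauss words\<close>

datatype 'a passage = Tail (letter: 'a) | Head (letter: 'a)

text \<open>A word together with the signs of its letters; the sign function is only relevant on the
  letters that occur in the word.\<close>

type_synonym 'a signed_word = "'a passage list \<times> ('a \<Rightarrow> int)"

definition letters :: "'a passage list \<Rightarrow> 'a set" where
  "letters w = letter ` set w"

definition oriented_gauss_word :: "'a signed_word \<Rightarrow> bool" where
  "oriented_gauss_word G \<longleftrightarrow>
     (\<forall>i \<in> letters (fst G). count_list (fst G) (Tail i) = 1 \<and> count_list (fst G) (Head i) = 1
        \<and> snd G i \<in> {1, -1})"


section \<open>Arrow diagrams\<close>

definition relabeling :: "'a signed_word \<Rightarrow> 'b signed_word \<Rightarrow> bool" where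
  "relabeling G G' \<longleftrightarrow>
     (\<exists>f. inj_on f (letters (fst G)) \<and> fst G' = map (map_passage f) (fst G)
        \<and> (\<forall>i \<in> letters (fst G). snd G' (f i) = snd G i))"

text \<open>An arrow diagram is a class of words. Since words are finite, every class has
  representatives with natural numbers as letters, and we take the class to consist of these;
  thus words over different alphabets can be compared.\<close>

type_synonym arrow_diagram = "nat signed_word set"

definition based_class :: "'a signed_word \<Rightarrow> arrow_diagram" where
  "based_class G = {G'. relabeling G G'}"

definition unbased_class :: "'a signed_word \<Rightarrow> arrow_diagram" where
  "unbased_class G = {G'. \<exists>n. relabeling (rotate n (fst G), snd G) G'}"

text \<open>The sum of all arrow diagrams obtained from an unsigned word by assigning signs. It ranges
  over the set of resulting diagrams: sign assignments related by a symmetry of the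
  diagram contribute a single summand.\<close>

definition sign_assignments :: "'a passage list \<Rightarrow> ('a \<Rightarrow> int) set" where
  "sign_assignments w = (letters w \<rightarrow>\<^sub>E {1, -1})"

definition based_unsigned :: "'a passage list \<Rightarrow> arrow_diagram \<Rightarrow>\<^sub>0 int" where
  "based_unsigned w = (\<Sum>x \<in> (\<lambda>s. based_class (w, s)) ` sign_assignments w. frag_of x)"

definition unbased_unsigned :: "'a passage list \<Rightarrow> arrow_diagram \<Rightarrow>\<^sub>0 int" where
  "unbased_unsigned w = (\<Sum>x \<in> (\<lambda>s. unbased_class (w, s)) ` sign_assignments w. frag_of x)"


section \<open>The pairing\<close>

definition subwords :: "'a signed_word \<Rightarrow> 'a signed_word set" where
  "subwords G = {(filter (\<lambda>p. letter p \<notin> S) (fst G), snd G) | S. S \<subseteq> letters (fst G)}"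

definition word_sign :: "'a signed_word \<Rightarrow> int" where
  "word_sign G = (\<Prod>i \<in> letters (fst G). snd G i)"

definition based_pairing :: "(arrow_diagram \<Rightarrow>\<^sub>0 int) \<Rightarrow> 'a signed_word \<Rightarrow> int" where
  "based_pairing f G =
     (\<Sum>x \<in> Poly_Mapping.keys f. Poly_Mapping.lookup f x *
        (\<Sum>H' \<in> {H' \<in> subwords G. based_class H' = x}. word_sign H'))"

definition unbased_pairing :: "(arrow_diagram \<Rightarrow>\<^sub>0 int) \<Rightarrow> 'a signed_word \<Rightarrow> int" where
  "unbased_pairing f G =
     (\<Sum>x \<in> Poly_Mapping.keys f. Poly_Mapping.lookup f x *
        (\<Sum>H' \<in> {H' \<in> subwords G. unbased_class H' = x}. word_sign H'))"


section \<open>Classical knot diagrams\<close>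

text \<open>An oriented planar diagram with base point: a closed curve of period \<open>1\<close>, parametrized
  along its orientation and starting at the base point, and the set of those
  parameters at which it passes over a crossing.\<close>

record knot_diagram =
  curve :: "real \<Rightarrow> complex"
  over :: "real set"

definition velocity :: "knot_diagram \<Rightarrow> real \<Rightarrow> complex" where
  "velocity D t = vector_derivative (curve D) (at t)"

definition passage_times :: "knot_diagram \<Rightarrow> real set" where
  "passage_times D = {t \<in> {0..<1}. \<exists>s \<in> {0..<1}. s \<noteq> t \<and> curve D s = curve D t}"

text \<open>\<open>Im (cnj u * v)\<close> is the determinant of the pair \<open>(u, v)\<close> of plane vectors.\<close>

definition classical_based_knot_diagram :: "knot_diagram \<Rightarrow> bool" where
  "classical_based_knot_diagram D \<longleftrightarrow>
     (\<forall>t. curve D (t + 1) = curve D t) \<and>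
     curve D C1_differentiable_on UNIV \<and>
     (\<forall>t. velocity D t \<noteq> 0) \<and>
     finite (passage_times D) \<and>
     (\<forall>t \<in> passage_times D. card {s \<in> {0..<1}. curve D s = curve D t} = 2) \<and>
     (\<forall>s \<in> {0..<1}. \<forall>t \<in> {0..<1}. s \<noteq> t \<and> curve D s = curve D t \<longrightarrow>
        Im (cnj (velocity D s) * velocity D t) \<noteq> 0 \<and> (s \<in> over D \<longleftrightarrow> t \<notin> over D)) \<and>
     0 \<notin> passage_times D"

definition over_time :: "knot_diagram \<Rightarrow> complex \<Rightarrow> real" where
  "over_time D c = (THE t. t \<in> passage_times D \<and> curve D t = c \<and> t \<in> over D)"

definition under_time :: "knot_diagram \<Rightarrow> complex \<Rightarrow> real" where
  "under_time D c = (THE t. t \<in> passage_times D \<and> curve D t = c \<and> t \<notin> over D)"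

definition crossing_sign :: "knot_diagram \<Rightarrow> complex \<Rightarrow> int" where
  "crossing_sign D c =
     (if Im (cnj (velocity D (over_time D c)) * velocity D (under_time D c)) > 0 then 1 else -1)"

text \<open>The letters of the Gauss word are the crossings themselves, as points of the plane.\<close>

definition gauss_word :: "knot_diagram \<Rightarrow> complex signed_word" where
  "gauss_word D =
     (map (\<lambda>t. if t \<in> over D then Tail (curve D t) else Head (curve D t))
        (sorted_list_of_set (passage_times D)),
      crossing_sign D)"

lemma oriented_gauss_word_gauss_word:
  assumes "classical_based_knot_diagram D"
  shows "oriented_gauss_word (gauss_word D)"
proof -
  let ?P = "passage_times D" and ?p = "\<lambda>t. if t \<in> over D then Tail (curve D t) else Head (curve D t)"
  have fin: "finite ?P"
    using assms by (simp add: classical_based_knot_diagram_def)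
  have alt: "s \<in> over D \<longleftrightarrow> t \<notin> over D" if "s \<in> ?P" "t \<in> ?P" "s \<noteq> t" "curve D s = curve D t" for s t
    using assms that by (simp add: classical_based_knot_diagram_def passage_times_def)
  have inj: "inj_on ?p ?P"
  proof (rule inj_onI)
    fix s t assume st: "s \<in> ?P" "t \<in> ?P" "?p s = ?p t"
    then have "curve D s = curve D t" "s \<in> over D \<longleftrightarrow> t \<in> over D"
      by (simp_all split: if_splits)
    with alt[OF st(1,2)] show "s = t" by blast
  qed
  have dist: "distinct (fst (gauss_word D))"
    using fin inj by (simp add: gauss_word_def distinct_map)
  have set: "set (fst (gauss_word D)) = ?p ` ?P"
    using fin by (simp add: gauss_word_def)
  have both: "Tail i \<in> ?p ` ?P \<and> Head i \<in> ?p ` ?P" if i: "i \<in> letters (fst (gauss_word D))" for i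
  proof -
    obtain t where t: "t \<in> ?P" "i = letter (?p t)"
      using i unfolding letters_def set by blast
    have it: "i = curve D t"
      using t(2) by (cases "t \<in> over D") simp_all
    obtain s where s: "s \<in> ?P" "s \<noteq> t" "curve D s = curve D t"
      using t(1) unfolding passage_times_def by (smt (verit) mem_Collect_eq)
    have "?p s \<in> ?p ` ?P" "?p t \<in> ?p ` ?P"
      using s t by blast+
    with alt[OF s(1) t(1) s(2,3)] s(3) it show ?thesis
      by (cases "t \<in> over D") simp_all
  qed
  have count: "count_list xs x = 1" if "distinct xs" "x \<in> set xs" for xs :: "complex passage list" and x
    using that by (induction xs) (auto simp: count_list_0_iff)
  have "count_list (fst (gauss_word D)) (Tail i) = 1 \<and> count_list (fst (gauss_word D)) (Head i) = 1"
    if "i \<in> letters (fst (gauss_word D))" for i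
    using both[OF that] count[OF dist] unfolding set by blast
  moreover have "snd (gauss_word D) i \<in> {1, -1}" for i
    by (simp add: gauss_word_def crossing_sign_def)
  ultimately show ?thesis
    unfolding oriented_gauss_word_def by blast
qed


section \<open>The formulas\<close>

definition X_word :: "nat passage list" where
  "X_word = [Head 1, Tail 3, Head 2, Tail 1, Head 3, Tail 2]"

definition X1_word :: "nat passage list" where
  "X1_word = [Head 2, Tail 1, Head 3, Tail 2, Head 1, Tail 3]"

definition X2_word :: "nat passage list" where
  "X2_word = [Tail 3, Head 2, Tail 1, Head 3, Tail 2, Head 1]"

text \<open>The letters \<open>a\<close>, \<open>b\<close>, \<open>c\<close> are \<open>1\<close>, \<open>2\<close>, \<open>3\<close>.\<close>

definition H_word :: "nat passage list" where
  "H_word = [Head 3, Tail 2, Head 1, Tail 3, Tail 1, Head 2]"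

definition f37 :: "arrow_diagram \<Rightarrow>\<^sub>0 int" where
  "f37 = (\<Sum>m = 1..6. based_unsigned (rotate (m - 1) H_word))
     + frag_cmul 2 (based_unsigned X1_word + based_unsigned X2_word)"

definition v37 :: "knot_diagram \<Rightarrow> int" where
  "v37 D = based_pairing f37 (gauss_word D)"

end

theory Submission
  imports Defs
begin

text \<open>Both pairings are sums over the subwords of the Gauss word, weighted by the coefficient of the
  class of the subword, so it suffices to compare coefficients. A subword lies in the cyclic class
  of an unsigned word iff it is a relabeling of one of its six rotations. The rotations of \<open>H\<close> are
  told apart by their patterns of heads and tails, hence at most one of the \<open>H_m\<close> is matched. The
  rotation by two steps is a symmetry of \<open>X\<close>, hence its rotations fall into the two classes \<open>X_1\<close>
  and \<open>X_2\<close>, again told apart by their patterns.\<close>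

section \<open>Relabelings\<close>

text \<open>The sign-free part of \<open>relabeling\<close>: it decides which subwords are matched
  by an unsigned diagram, whatever signs their letters carry.\<close>

definition unsigned_relabeling :: "'a passage list \<Rightarrow> 'b passage list \<Rightarrow> bool" where
  "unsigned_relabeling w v \<longleftrightarrow> (\<exists>f. inj_on f (letters w) \<and> v = map (map_passage f) w)"

lemma letters_map_passage: "letters (map (map_passage f) w) = f ` letters w"
proof -
  have "letter (map_passage f p) = f (letter p)" for p
    by (cases p) simp_all
  then show ?thesis
    by (simp add: letters_def image_image)
qed

lemma letters_rotate [simp]: "letters (rotate n w) = letters w"
  by (simp add: letters_def)

lemma finite_letters [simp]: "finite (letters w)"
  by (simp add: letters_def)

lemma map_map_passage_cong:
  assumes "\<And>i. i \<in> letters w \<Longrightarrow> f i = g i"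
  shows "map (map_passage f) w = map (map_passage g) w"
proof (rule map_cong[OF refl])
  fix p assume "p \<in> set w"
  then have "f (letter p) = g (letter p)"
    using assms by (simp add: letters_def)
  then show "map_passage f p = map_passage g p"
    by (cases p) simp_all
qed

lemma map_map_passage_comp:
  "map (map_passage g) (map (map_passage f) w) = map (map_passage (g \<circ> f)) w"
  by (simp add: passage.map_comp)

lemma relabeling_refl: "relabeling G G"
  unfolding relabeling_def by (rule exI[of _ id]) (simp add: passage.map_id0)

lemma relabeling_sym:
  assumes "relabeling G G'"
  shows "relabeling G' G"
proof -
  obtain f where f: "inj_on f (letters (fst G))" "fst G' = map (map_passage f) (fst G)"
    "\<forall>i \<in> letters (fst G). snd G' (f i) = snd G i"
    using assms unfolding relabeling_def by blast
  \<comment> \<open>Injectivity of \<open>f\<close> is known only on the letters of the word, so the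
    inverse is formed relative to that set.\<close>
  let ?g = "inv_into (letters (fst G)) f"
  have "map (map_passage ?g) (fst G') = map (map_passage id) (fst G)"
    unfolding f(2) map_map_passage_comp by (rule map_map_passage_cong) (simp add: f(1))
  then have "fst G = map (map_passage ?g) (fst G')"
    by (simp add: passage.map_id0)
  moreover have "letters (fst G') = f ` letters (fst G)"
    by (simp add: f(2) letters_map_passage)
  ultimately show ?thesis
    unfolding relabeling_def using f
    by (intro exI[of _ ?g]) (auto simp: inj_on_inv_into)
qed

lemma relabeling_trans:
  assumes "relabeling G G'" "relabeling G' G''"
  shows "relabeling G G''"
proof -
  obtain f where f: "inj_on f (letters (fst G))" "fst G' = map (map_passage f) (fst G)"
    "\<forall>i \<in> letters (fst G). snd G' (f i) = snd G i"
    using assms(1) unfolding relabeling_def by blast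
  obtain g where g: "inj_on g (letters (fst G'))" "fst G'' = map (map_passage g) (fst G')"
    "\<forall>i \<in> letters (fst G'). snd G'' (g i) = snd G' i"
    using assms(2) unfolding relabeling_def by blast
  have "letters (fst G') = f ` letters (fst G)"
    by (simp add: f(2) letters_map_passage)
  then show ?thesis
    unfolding relabeling_def using f g
    by (intro exI[of _ "g \<circ> f"]) (auto intro: comp_inj_on simp: passage.map_comp)
qed

lemma relabeling_rotate:
  "relabeling (w, s) (w', s') \<Longrightarrow> relabeling (rotate n w, s) (rotate n w', s')"
  by (auto simp: relabeling_def rotate_map)

lemma relabeling_imp_unsigned: "relabeling G G' \<Longrightarrow> unsigned_relabeling (fst G) (fst G')"
  by (auto simp: relabeling_def unsigned_relabeling_def)

lemma unsigned_relabeling_trans: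
  assumes "unsigned_relabeling u v" "unsigned_relabeling v w"
  shows "unsigned_relabeling u w"
proof -
  obtain f g where f: "inj_on f (letters u)" "v = map (map_passage f) u"
    and g: "inj_on g (letters v)" "w = map (map_passage g) v"
    using assms unfolding unsigned_relabeling_def by blast
  have "inj_on (g \<circ> f) (letters u)"
    using f g(1) by (simp add: comp_inj_on letters_map_passage)
  then show ?thesis
    unfolding unsigned_relabeling_def g(2) f(2) map_map_passage_comp by blast
qed

text \<open>Pulling the signs of \<open>G\<close> back along the relabeling turns an unsigned match
  into a signed one.\<close>

lemma unsigned_relabeling_sign:
  fixes G :: "'a signed_word"
  assumes "unsigned_relabeling w (fst G)" "\<And>i. i \<in> letters (fst G) \<Longrightarrow> snd G i \<in> {1, -1}"
  obtains s where "s \<in> sign_assignments w" "relabeling (w, s) G"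
proof -
  obtain f where f: "inj_on f (letters w)" "fst G = map (map_passage f) w"
    using assms(1) unfolding unsigned_relabeling_def by blast
  \<comment> \<open>The restriction is needed because \<open>sign_assignments\<close> is an
    extensional function space.\<close>
  let ?s = "restrict (snd G \<circ> f) (letters w)"
  have "f i \<in> letters (fst G)" if "i \<in> letters w" for i
    using that by (simp add: f(2) letters_map_passage)
  then have "?s \<in> sign_assignments w"
    unfolding sign_assignments_def restrict_PiE_iff using assms(2) by fastforce
  moreover have "relabeling (w, ?s) G"
    using f by (auto simp: relabeling_def)
  ultimately show thesis ..
qed


section \<open>Classes\<close>

lemma rotate_rotate_cancel: "\<exists>k. rotate k (rotate n w) = w"
proof (cases "w = []")
  case False
  \<comment> \<open>The total rotation is to be \<open>n\<close> full turns. As \<open>w\<close> is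
    nonempty, \<open>n\<close> is at most \<open>n * length w\<close> and the subtraction is
    exact.\<close>
  then have "n * length w - n + n = n * length w"
    by (simp add: Suc_leI)
  then have "rotate (n * length w - n) (rotate n w) = w"
    by (simp add: rotate_rotate rotate_id)
  then show ?thesis ..
qed simp

lemma based_class_eq:
  assumes "relabeling G G'"
  shows "based_class G = based_class G'"
  unfolding based_class_def
  using relabeling_trans[OF assms] relabeling_trans[OF relabeling_sym[OF assms]]
  by (intro Collect_cong) iprover

lemma unbased_class_altdef: "unbased_class G = (\<Union>n. based_class (rotate n (fst G), snd G))"
  by (auto simp: unbased_class_def based_class_def)

lemma unbased_class_eq:
  assumes "relabeling G G'"
  shows "unbased_class G = unbased_class G'"
proof -
  have "based_class (rotate n (fst G), snd G) = based_class (rotate n (fst G'), snd G')" for n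
    using assms by (intro based_class_eq relabeling_rotate) simp
  then show ?thesis
    by (simp add: unbased_class_altdef)
qed

text \<open>Rotations can be undone by rotations, so a word and any rotation of it have the same set
  of rotations.\<close>

lemma unbased_class_rotate: "unbased_class (rotate n w, s) = unbased_class (w, s)"
proof
  show "unbased_class (rotate n w, s) \<subseteq> unbased_class (w, s)"
    by (auto simp: unbased_class_altdef rotate_rotate)
  obtain k where k: "rotate k (rotate n w) = w"
    using rotate_rotate_cancel by blast
  show "unbased_class (w, s) \<subseteq> unbased_class (rotate n w, s)"
    unfolding unbased_class_altdef fst_conv snd_conv
  proof (rule UN_least)
    fix m
    have "rotate m w = rotate (m + k) (rotate n w)"
      by (simp add: k flip: rotate_rotate[of m k])
    then show "based_class (rotate m w, s) \<subseteq> (\<Union>m. based_class (rotate m (rotate n w), s))"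
      using UN_upper[of "m + k" UNIV "\<lambda>m. based_class (rotate m (rotate n w), s)"] by simp
  qed
qed

lemma based_class_in_unsigned_iff:
  fixes w :: "nat passage list" and G :: "'a signed_word"
  assumes "\<And>i. i \<in> letters (fst G) \<Longrightarrow> snd G i \<in> {1, -1}"
  shows "based_class G \<in> (\<lambda>s. based_class (w, s)) ` sign_assignments w
    \<longleftrightarrow> unsigned_relabeling w (fst G)"
proof
  assume "based_class G \<in> (\<lambda>s. based_class (w, s)) ` sign_assignments w"
  then obtain s where "based_class G = based_class (w, s)"
    by blast
  \<comment> \<open>Having natural numbers as letters, \<open>(w, s)\<close> is a member of its own
    class, which is also the class of \<open>G\<close>.\<close>
  then have "relabeling G (w, s)"
    using relabeling_refl unfolding based_class_def by blast
  then show "unsigned_relabeling w (fst G)"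
    using relabeling_imp_unsigned relabeling_sym by fastforce
next
  assume "unsigned_relabeling w (fst G)"
  then obtain s where "s \<in> sign_assignments w" "relabeling (w, s) G"
    using unsigned_relabeling_sign assms by blast
  then show "based_class G \<in> (\<lambda>s. based_class (w, s)) ` sign_assignments w"
    using based_class_eq by blast
qed

lemma unbased_class_in_unsigned_iff:
  fixes w :: "nat passage list" and G :: "'a signed_word"
  assumes "\<And>i. i \<in> letters (fst G) \<Longrightarrow> snd G i \<in> {1, -1}"
  shows "unbased_class G \<in> (\<lambda>s. unbased_class (w, s)) ` sign_assignments w
    \<longleftrightarrow> (\<exists>n. unsigned_relabeling (rotate n w) (fst G))"
proof
  assume "unbased_class G \<in> (\<lambda>s. unbased_class (w, s)) ` sign_assignments w"
  then obtain s where s: "unbased_class G = unbased_class (w, s)"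
    by blast
  have "(w, s) \<in> unbased_class (w, s)"
    unfolding unbased_class_def using relabeling_refl[of "(w, s)"] by (auto intro!: exI[of _ 0])
  then obtain n where "relabeling (rotate n (fst G), snd G) (w, s)"
    unfolding s[symmetric] by (auto simp: unbased_class_def)
  \<comment> \<open>Undoing the rotation moves it from the word of \<open>G\<close> to
    \<open>w\<close>.\<close>
  moreover obtain k where "rotate k (rotate n (fst G)) = fst G"
    using rotate_rotate_cancel by blast
  ultimately have "relabeling (rotate k w, s) G"
    using relabeling_rotate relabeling_sym by (metis prod.collapse)
  then show "\<exists>n. unsigned_relabeling (rotate n w) (fst G)"
    using relabeling_imp_unsigned by fastforce
next
  assume "\<exists>n. unsigned_relabeling (rotate n w) (fst G)"
  then obtain n where "unsigned_relabeling (rotate n w) (fst G)" ..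
  then obtain s where s: "s \<in> sign_assignments (rotate n w)" "relabeling (rotate n w, s) G"
    using unsigned_relabeling_sign assms by blast
  have "unbased_class G = unbased_class (w, s)"
    using unbased_class_eq[OF s(2)] unbased_class_rotate by metis
  moreover have "s \<in> sign_assignments w"
    using s(1) by (simp add: sign_assignments_def)
  ultimately show "unbased_class G \<in> (\<lambda>s. unbased_class (w, s)) ` sign_assignments w"
    by blast
qed


section \<open>Coefficients\<close>

lemma finite_subwords: "finite (subwords G)"
proof -
  have "subwords G = (\<lambda>S. (filter (\<lambda>p. letter p \<notin> S) (fst G), snd G)) ` Pow (letters (fst G))"
    by (auto simp: subwords_def)
  then show ?thesis
    by simp
qed

text \<open>Summation over the fibers of \<open>c\<close> is exchanged for summation over
  \<open>A\<close>; elements sent outside the support of \<open>f\<close> have coefficient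
  0.\<close>

lemma sum_keys_fibers:
  fixes f :: "'a \<Rightarrow>\<^sub>0 int"
  assumes "finite A"
  shows "(\<Sum>x \<in> Poly_Mapping.keys f. Poly_Mapping.lookup f x * (\<Sum>a \<in> {a \<in> A. c a = x}. g a))
    = (\<Sum>a \<in> A. Poly_Mapping.lookup f (c a) * g a)" (is "?l = _")
proof -
  have "?l = (\<Sum>x \<in> Poly_Mapping.keys f. \<Sum>a \<in> A. if c a = x then Poly_Mapping.lookup f x * g a else 0)"
    using assms by (simp add: sum_distrib_left sum.inter_filter if_distrib cong: if_cong)
  also have "\<dots> = (\<Sum>a \<in> A. \<Sum>x \<in> Poly_Mapping.keys f. if c a = x then Poly_Mapping.lookup f x * g a else 0)"
    by (rule sum.swap)
  also have "\<dots> = (\<Sum>a \<in> A. Poly_Mapping.lookup f (c a) * g a)"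
    by (intro sum.cong) (auto simp: in_keys_iff)
  finally show ?thesis .
qed

lemma based_pairing_altdef:
  "based_pairing f G = (\<Sum>H \<in> subwords G. Poly_Mapping.lookup f (based_class H) * word_sign H)"
  unfolding based_pairing_def by (rule sum_keys_fibers[OF finite_subwords])

lemma unbased_pairing_altdef:
  "unbased_pairing f G = (\<Sum>H \<in> subwords G. Poly_Mapping.lookup f (unbased_class H) * word_sign H)"
  unfolding unbased_pairing_def by (rule sum_keys_fibers[OF finite_subwords])

lemma lookup_sum_frag_of:
  assumes "finite A"
  shows "Poly_Mapping.lookup (\<Sum>x \<in> A. frag_of x) y = of_bool (y \<in> A)"
proof -
  have "Poly_Mapping.lookup (\<Sum>x \<in> A. frag_of x) y = (\<Sum>x \<in> A. if x = y then 1 else 0)"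
    unfolding Poly_Mapping.lookup_sum by (intro sum.cong) (simp_all add: lookup_single when_def)
  then show ?thesis
    using assms by simp
qed

lemma finite_sign_assignments: "finite (sign_assignments w)"
  by (simp add: sign_assignments_def finite_PiE)

lemma lookup_based_unsigned:
  fixes w :: "nat passage list" and G :: "'a signed_word"
  assumes "\<And>i. i \<in> letters (fst G) \<Longrightarrow> snd G i \<in> {1, -1}"
  shows "Poly_Mapping.lookup (based_unsigned w) (based_class G) = of_bool (unsigned_relabeling w (fst G))"
  by (simp add: based_unsigned_def lookup_sum_frag_of finite_sign_assignments
      based_class_in_unsigned_iff[OF assms])

text \<open>The coefficient is at most 1 even if several sign assignments give the same cyclic
  diagram, since the sum runs over the set of diagrams.\<close>

lemma lookup_unbased_unsigned:
  fixes w :: "nat passage list" and G :: "'a signed_word"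
  assumes "\<And>i. i \<in> letters (fst G) \<Longrightarrow> snd G i \<in> {1, -1}"
  shows "Poly_Mapping.lookup (unbased_unsigned w) (unbased_class G)
    = of_bool (\<exists>n. unsigned_relabeling (rotate n w) (fst G))"
  by (simp add: unbased_unsigned_def lookup_sum_frag_of finite_sign_assignments
      unbased_class_in_unsigned_iff[OF assms])


section \<open>The rotations of \<open>H\<close> and \<open>X\<close>\<close>

text \<open>Relabeling changes letters but not passage types, so the pattern of heads and tails is
  an invariant that can separate rotations.\<close>

lemma unsigned_relabeling_is_Tail:
  assumes "unsigned_relabeling w v"
  shows "map is_Tail v = map is_Tail w"
  using assms by (auto simp: unsigned_relabeling_def)

lemma ex_rotate_iff: "(\<exists>n. P (rotate n w)) \<longleftrightarrow> (\<exists>n < length w. P (rotate n w))" if "w \<noteq> []"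
  using that by (metis length_greater_0_conv mod_less_divisor rotate_conv_mod)

lemma ex_rotate_6_iff:
  assumes "length w = 6"
  shows "(\<exists>n. P (rotate n w)) \<longleftrightarrow> (\<exists>n \<in> {0, 1, 2, 3, 4, 5}. P (rotate n w))"
proof -
  have "w \<noteq> []"
    using assms by auto
  moreover have "n < 6 \<longleftrightarrow> n \<in> {0, 1, 2, 3, 4, 5}" for n :: nat
    by auto
  ultimately show ?thesis
    using ex_rotate_iff[of w P] assms by metis
qed

lemma sum_rotate_H:
  "(\<Sum>m = 1..6. of_bool (unsigned_relabeling (rotate (m - 1) H_word) v))
    = (of_bool (\<exists>n. unsigned_relabeling (rotate n H_word) v) :: int)"
proof -
  \<comment> \<open>The pattern head, tail, head, tail, tail, head has no rotational symmetry, so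
    its six rotations are distinct.\<close>
  have patterns: "\<forall>m \<in> {0, 1, 2, 3, 4, 5}. \<forall>n \<in> {0, 1, 2, 3, 4, 5}.
      map is_Tail (rotate m H_word) = map is_Tail (rotate n H_word) \<longrightarrow> m = n"
    by code_simp
  have unique: "m = n"
    if "unsigned_relabeling (rotate m H_word) v" "unsigned_relabeling (rotate n H_word) v"
      "m \<in> {0, 1, 2, 3, 4, 5}" "n \<in> {0, 1, 2, 3, 4, 5}" for m n
  proof -
    have "map is_Tail (rotate m H_word) = map is_Tail (rotate n H_word)"
      using that(1,2) unsigned_relabeling_is_Tail by metis
    then show ?thesis
      by (rule patterns[rule_format, OF that(3,4)])
  qed
  let ?P = "\<lambda>n. unsigned_relabeling (rotate n H_word) v"
  have "(\<Sum>m = 1..6. of_bool (?P (m - 1))) = (\<Sum>n \<in> {0, 1, 2, 3, 4, 5}. of_bool (?P n) :: int)"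
    by (rule sum.reindex_bij_witness[of _ Suc "\<lambda>m. m - 1"]) auto
  also have "\<dots> = of_bool (\<exists>n \<in> {0, 1, 2, 3, 4, 5}. ?P n)"
  proof (cases "\<exists>n \<in> {0, 1, 2, 3, 4, 5}. ?P n")
    case True
    then obtain n where n: "n \<in> {0, 1, 2, 3, 4, 5}" "?P n" by blast
    have "(\<Sum>k \<in> {0, 1, 2, 3, 4, 5}. of_bool (?P k) :: int)
        = (\<Sum>k \<in> {0, 1, 2, 3, 4, 5}. if k = n then 1 else 0)"
    proof (rule sum.cong[OF refl])
      fix k :: nat assume "k \<in> {0, 1, 2, 3, 4, 5}"
      then have "?P k \<longleftrightarrow> k = n"
        using n(2) unique[OF _ n(2) _ n(1)] by metis
      then show "(of_bool (?P k) :: int) = (if k = n then 1 else 0)"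
        by simp
    qed
    also have "\<dots> = 1"
      using n(1) by (subst sum.delta) auto
    finally show ?thesis
      using True by simp
  next
    case False
    then show ?thesis
      by (simp add: sum.neutral)
  qed
  also have "(\<exists>n \<in> {0, 1, 2, 3, 4, 5}. ?P n) \<longleftrightarrow> (\<exists>n. ?P n)"
    by (rule ex_rotate_6_iff[symmetric]) (simp add: H_word_def)
  finally show ?thesis .
qed

lemma of_bool_X:
  "of_bool (unsigned_relabeling X1_word v) + of_bool (unsigned_relabeling X2_word v)
    = (of_bool (\<exists>n. unsigned_relabeling (rotate n X_word) v) :: int)"
proof -
  have X1: "X1_word = rotate 2 X_word" and X2: "X2_word = rotate 1 X_word"
    by (simp_all add: X1_word_def X2_word_def X_word_def numeral_eq_Suc)
  have sym: "unsigned_relabeling (rotate n X_word) (rotate (n + 2) X_word)" for n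
  proof -
    \<comment> \<open>The cyclic permutation of the three letters realizes the threefold symmetry of
      \<open>X\<close>.\<close>
    have "rotate 2 X_word = map (map_passage (id(1 := 2, 2 := 3, 3 := 1))) X_word"
      by (simp add: X_word_def numeral_eq_Suc)
    then have "rotate (n + 2) X_word
        = map (map_passage (id(1 := 2, 2 := 3, 3 := 1))) (rotate n X_word)"
      by (metis rotate_map rotate_rotate)
    moreover have "inj_on (id(1 := 2, 2 := 3, 3 := 1)) (letters (rotate n X_word))"
      by (simp add: X_word_def letters_def)
    ultimately show ?thesis
      unfolding unsigned_relabeling_def by blast
  qed
  let ?P = "\<lambda>n. unsigned_relabeling (rotate n X_word) v"
  have step: "?P n" if "?P m" "m = n + 2" for m n
    using sym that unsigned_relabeling_trans by blast
  \<comment> \<open>Each step lowers the index by two. Reading rotation 0 as rotation 6 lets the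
    even rotations descend to 2, which is \<open>X1_word\<close>, and the odd ones to 1, which is
    \<open>X2_word\<close>.\<close>
  have wrap: "rotate 6 X_word = rotate 0 X_word"
    by (simp add: X_word_def numeral_eq_Suc)
  have "?P 4 \<Longrightarrow> ?P 2" "?P 6 \<Longrightarrow> ?P 4" "?P 5 \<Longrightarrow> ?P 3" "?P 3 \<Longrightarrow> ?P 1"
    by (erule step; simp)+
  then have "(\<exists>n \<in> {0, 1, 2, 3, 4, 5}. ?P n) \<longleftrightarrow> ?P 2 \<or> ?P 1"
    unfolding wrap by blast
  then have "(\<exists>n. ?P n) \<longleftrightarrow> ?P 2 \<or> ?P 1"
    by (subst ex_rotate_6_iff) (simp_all add: X_word_def)
  moreover have "\<not> (?P 2 \<and> ?P 1)"
  proof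
    \<comment> \<open>The first of these rotations starts with a head, the second with a
      tail.\<close>
    assume "?P 2 \<and> ?P 1"
    then have "map is_Tail (rotate 2 X_word) = map is_Tail (rotate 1 X_word)"
      using unsigned_relabeling_is_Tail by metis
    then show False
      by (simp add: X_word_def numeral_eq_Suc)
  qed
  ultimately show ?thesis
    unfolding X1 X2 by auto
qed

section \<open>Equality of the based and the cyclic pairing\<close>

theorem corollary1:
  fixes D :: knot_diagram
  assumes "classical_based_knot_diagram D"
  shows "v37 D =
    unbased_pairing (frag_cmul 2 (unbased_unsigned X_word) + unbased_unsigned H_word) (gauss_word D)"
proof -
  have "Poly_Mapping.lookup f37 (based_class H) =
      Poly_Mapping.lookup (frag_cmul 2 (unbased_unsigned X_word) + unbased_unsigned H_word)
        (unbased_class H)"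
    if "H \<in> subwords (gauss_word D)" for H
  proof -
    \<comment> \<open>A subword keeps the sign function of the whole Gauss word, which takes the
      values 1 and -1 at every point of the plane.\<close>
    have sign: "snd H i \<in> {1, -1}" for i
    proof -
      have "snd H = crossing_sign D"
        using \<open>H \<in> _\<close> by (auto simp: subwords_def gauss_word_def)
      then show ?thesis
        by (simp add: crossing_sign_def)
    qed
    have "Poly_Mapping.lookup f37 (based_class H) =
      (\<Sum>m = 1..6. of_bool (unsigned_relabeling (rotate (m - 1) H_word) (fst H))) +
      2 * (of_bool (unsigned_relabeling X1_word (fst H)) + of_bool (unsigned_relabeling X2_word (fst H)))"
      unfolding f37_def lookup_add Poly_Mapping.lookup_sum lookup_frag_cmul
        lookup_based_unsigned[OF sign] ..
    then show ?thesis
      unfolding lookup_add lookup_frag_cmul lookup_unbased_unsigned[OF sign] sum_rotate_H of_bool_X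
      by simp
  qed
  then show ?thesis
    by (simp add: v37_def based_pairing_altdef unbased_pairing_altdef)
qed

end
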